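(* Let $(X,T)$ be a minimal subshift with $X$ infinite, and let $S$ be a bounded speedup of $T$ with jump function $p$; that is, $p:X\to\mathbb{Z}^+$ is a bounded function such that $S(x)=T^{p(x)}(x)$ defines a homeomorphism $S:X\to X$. Then $(X,T)$ is not topologically conjugate to $(X,S)$.
   Context: For a finite alphabet $\mathcal{A}$, a subshift is a closed shift-invariant subset $X\subset\mathcal{A}^{\mathbb{Z}}$ together with the restriction to $X$ of the shift map $T(x)_k=x_{k+1}$. It is minimal if all $T$-orbits are dense in $X$. Here $\mathbb{Z}^+$ denotes the set of positive integers. Two systems $(X,T)$ and $(Y,R)$ are topologically conjugate if there is a homeomorphism $\phi:X\to Y$ with $\phi\circ T=R\circ\phi$.
   Formalization: The jump function p is additionally assumed not to be identically 1 on X, since for p ≡ 1 one has S = T and the identity map is a conjugacy, so the claim fails. *)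

theory Defs
  imports "HOL-Analysis.Analysis"
begin

text \<open>Bi-infinite sequences over the alphabet \<open>A\<close>, a set of symbols in an arbitrary type, with the
  product of the discrete topologies; the topspace is the set of all \<open>x\<close> with \<open>x k \<in> A\<close> for every
  \<open>k\<close>.\<close>

definition full_shift :: "'a set \<Rightarrow> (int \<Rightarrow> 'a) topology" where
  "full_shift A = product_topology (\<lambda>_. discrete_topology A) UNIV"

definition shift :: "(int \<Rightarrow> 'a) \<Rightarrow> (int \<Rightarrow> 'a)" where
  "shift x = (\<lambda>k. x (k + 1))"

text \<open>Invariance is the two-sided condition, so that the shift restricts to a bijection of \<open>X\<close>.\<close>

definition subshift :: "'a set \<Rightarrow> (int \<Rightarrow> 'a) set \<Rightarrow> bool" where
  "subshift A X \<longleftrightarrow> finite A \<and> closedin (full_shift A) X \<and> shift ` X = X"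

definition subshift_space :: "'a set \<Rightarrow> (int \<Rightarrow> 'a) set \<Rightarrow> (int \<Rightarrow> 'a) topology" where
  "subshift_space A X = subtopology (full_shift A) X"

text \<open>Two-sided orbits: the negative iterates use the inverse of \<open>T\<close> on \<open>topspace X\<close>, so this is
  meaningful when \<open>T\<close> maps \<open>topspace X\<close> bijectively onto itself.\<close>

definition full_orbit :: "'b topology \<Rightarrow> ('b \<Rightarrow> 'b) \<Rightarrow> 'b \<Rightarrow> 'b set" where
  "full_orbit X T x =
     range (\<lambda>n::nat. (T ^^ n) x) \<union> range (\<lambda>n::nat. (inv_into (topspace X) T ^^ n) x)"

definition minimal_system :: "'b topology \<Rightarrow> ('b \<Rightarrow> 'b) \<Rightarrow> bool" where
  "minimal_system X T \<longleftrightarrow>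
     (\<forall>x\<in>topspace X. X closure_of full_orbit X T x = topspace X)"

text \<open>The jump function \<open>p\<close> is not assumed to be continuous. The values of \<open>p\<close> and \<open>S\<close> outside
  \<open>topspace X\<close> are irrelevant.\<close>

definition bounded_speedup ::
    "'b topology \<Rightarrow> ('b \<Rightarrow> 'b) \<Rightarrow> ('b \<Rightarrow> nat) \<Rightarrow> ('b \<Rightarrow> 'b) \<Rightarrow> bool" where
  "bounded_speedup X T p S \<longleftrightarrow>
     (\<forall>x\<in>topspace X. 0 < p x) \<and>
     bdd_above (p ` topspace X) \<and>
     (\<forall>x\<in>topspace X. S x = (T ^^ p x) x) \<and>
     homeomorphic_map X X S"

definition topologically_conjugate ::
    "'b topology \<Rightarrow> ('b \<Rightarrow> 'b) \<Rightarrow> 'c topology \<Rightarrow> ('c \<Rightarrow> 'c) \<Rightarrow> bool" where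
  "topologically_conjugate X T Y R \<longleftrightarrow>
     (\<exists>\<phi>. homeomorphic_map X Y \<phi> \<and> (\<forall>x\<in>topspace X. \<phi> (T x) = R (\<phi> x)))"

end

theory Submission
  imports Defs
begin

text \<open>
  The proof compares the numbers of words of two lengths. Suppose that a homeomorphism \<open>\<phi>\<close> of \<open>X\<close>
  satisfies \<open>\<phi> \<circ> T = S \<circ> \<phi>\<close>, where \<open>T\<close> is the shift.

  Since \<open>X\<close> is infinite and minimal it has no periodic points, so \<open>p x = j\<close> holds exactly when
  \<open>S x = T\<^sup>j x\<close>; hence the level sets of \<open>p\<close> are closed, there are finitely many of them, and \<open>p\<close> is
  continuous. By compactness \<open>p\<close> and \<open>\<phi>\<close> are given by finite windows: \<open>p y\<close> depends only on
  \<open>y[-w, w]\<close>, where also \<open>p \<le> w\<close>, and \<open>\<phi>(x)[-w, w]\<close> depends only on \<open>x[-k, k]\<close>.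

  Let \<open>y = \<phi> x\<close>. The word \<open>x[-k, n - 1 + k]\<close> determines \<open>(S\<^sup>i y)[-w,
  w]\<close> for every \<open>i < n\<close>, because \<open>S\<^sup>i y = \<phi> (T\<^sup>i x)\<close>. These windows
  tell how far each step of \<open>S\<close> jumps and they overlap along the orbit, so they determine
  \<open>y\<close> on the whole stretch from \<open>0\<close> to \<open>q\<close>, the total length of the first
  \<open>n\<close> jumps. As \<open>p\<close> is not constantly \<open>1\<close>, the open set where it exceeds
  \<open>1\<close> is nonempty; under the conjugacy this set is visited by every orbit of \<open>S\<close> with
  bounded gaps because \<open>T\<close> is minimal; hence \<open>q - n\<close> is uniformly large when
  \<open>n\<close> is. For suitable \<open>n\<close> we get \<open>q > N\<close> with \<open>N = n + 2 k\<close>. As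
  \<open>\<phi>\<close> is onto, this is a surjection from the words of length \<open>N\<close> in \<open>X\<close>
  onto those of length \<open>N + 1\<close>. By the Morse-Hedlund argument
  (\<open>finite_if_complexity_stalls\<close>) a word of length \<open>N\<close> then extends uniquely in both
  directions, so that \<open>X\<close> is finite, a contradiction.
\<close>

section \<open>Cylinders and the topology of a subshift\<close>

definition shift_by :: "int \<Rightarrow> (int \<Rightarrow> 'a) \<Rightarrow> (int \<Rightarrow> 'a)" where
  "shift_by m x = (\<lambda>k. x (k + m))"

definition cylinder :: "(int \<Rightarrow> 'a) set \<Rightarrow> nat \<Rightarrow> (int \<Rightarrow> 'a) \<Rightarrow> (int \<Rightarrow> 'a) set" where
  "cylinder X w x = {y \<in> X. \<forall>k. \<bar>k\<bar> \<le> int w \<longrightarrow> y k = x k}"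

lemma shift_by_0 [simp]: "shift_by 0 x = x"
  by (simp add: shift_by_def)

lemma shift_by_shift_by [simp]: "shift_by m (shift_by n x) = shift_by (m + n) x"
  by (simp add: shift_by_def algebra_simps)

lemma shift_eq_shift_by: "shift = shift_by 1"
  by (simp add: fun_eq_iff shift_def shift_by_def)

lemma funpow_shift: "(shift ^^ n) x = shift_by (int n) x"
  by (induction n) (simp_all add: shift_eq_shift_by)

lemma shift_by_in:
  assumes "shift ` X = X" "x \<in> X"
  shows "shift_by m x \<in> X"
proof -
  have fwd: "shift_by 1 y \<in> X" if "y \<in> X" for y
    using assms(1) that by (auto simp: shift_eq_shift_by)
  have bwd: "shift_by (- 1) y \<in> X" if y: "y \<in> X" for y
  proof -
    obtain z where "z \<in> X" "y = shift_by 1 z"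
      using assms(1) y by (auto simp: shift_eq_shift_by)
    then show ?thesis by simp
  qed
  show ?thesis
  proof (induction m rule: int_induct[of _ 0])
    case base
    then show ?case using assms(2) by simp
  next
    case (step1 i)
    then show ?case using fwd[of "shift_by i x"] by (simp add: add.commute)
  next
    case (step2 i)
    then show ?case using bwd[of "shift_by i x"] by simp
  qed
qed

lemma cylinder_self: "x \<in> X \<Longrightarrow> x \<in> cylinder X w x"
  by (simp add: cylinder_def)

lemma cylinder_subset: "cylinder X w x \<subseteq> X"
  by (auto simp: cylinder_def)

lemma cylinder_anti_mono: "w \<le> w' \<Longrightarrow> cylinder X w' x \<subseteq> cylinder X w x"
  by (auto simp: cylinder_def)

context
  fixes A :: "'a set" and X :: "(int \<Rightarrow> 'a) set"
  assumes sub: "subshift A X"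
begin

lemma subshift_in_alphabet: "x \<in> X \<Longrightarrow> x k \<in> A"
  using sub closedin_subset[of "full_shift A" X]
  by (auto simp: subshift_def full_shift_def PiE_UNIV_domain)

lemma topspace_subshift_space [simp]: "topspace (subshift_space A X) = X"
  using sub closedin_subset[of "full_shift A" X]
  by (auto simp: subshift_def subshift_space_def)

lemma compact_subshift_space: "compact_space (subshift_space A X)"
proof -
  have "compact_space (full_shift A)"
    using sub unfolding full_shift_def subshift_def
    by (simp add: compact_space_product_topology compact_space_discrete_topology)
  then show ?thesis
    using sub unfolding subshift_def subshift_space_def
    by (meson closedin_compact_space compact_space_subtopology)
qed

lemma Hausdorff_subshift_space: "Hausdorff_space (subshift_space A X)"
  unfolding subshift_space_def full_shift_def
  by (simp add: Hausdorff_space_subtopology Hausdorff_space_product_topology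
      Hausdorff_space_discrete_topology)

lemma openin_subshift_space_iff:
  "openin (subshift_space A X) V \<longleftrightarrow> V \<subseteq> X \<and> (\<forall>x\<in>V. \<exists>w. cylinder X w x \<subseteq> V)"
proof (intro iffI conjI ballI)
  assume V: "openin (subshift_space A X) V"
  then show "V \<subseteq> X" using openin_subset topspace_subshift_space by blast
  fix x assume x: "x \<in> V"
  obtain W where W: "openin (full_shift A) W" "V = W \<inter> X"
    using V by (auto simp: subshift_space_def openin_subtopology)
  then obtain U where U: "finite {i. U i \<noteq> A}" "x \<in> Pi\<^sub>E UNIV U" "Pi\<^sub>E UNIV U \<subseteq> W"
    using x unfolding full_shift_def openin_product_topology_alt by fastforce
  \<comment> \<open>A basic open set constrains finitely many coordinates, which lie in one central window.\<close>
  obtain w where w: "\<And>i. U i \<noteq> A \<Longrightarrow> \<bar>i\<bar> \<le> int w"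
  proof
    fix i assume "U i \<noteq> A"
    then have "nat \<bar>i\<bar> \<le> (\<Sum>j\<in>{i. U i \<noteq> A}. nat \<bar>j\<bar>)"
      using U(1) by (intro member_le_sum) simp_all
    then show "\<bar>i\<bar> \<le> int (\<Sum>j\<in>{i. U i \<noteq> A}. nat \<bar>j\<bar>)" by linarith
  qed
  have "cylinder X w x \<subseteq> V"
  proof
    fix y assume y: "y \<in> cylinder X w x"
    then have "y i \<in> U i" for i
      using U(2) w[of i] subshift_in_alphabet[of y i]
      by (cases "U i = A") (auto simp: cylinder_def PiE_UNIV_domain)
    then show "y \<in> V" using U(3) W(2) y by (auto simp: cylinder_def PiE_UNIV_domain)
  qed
  then show "\<exists>w. cylinder X w x \<subseteq> V" ..
next
  assume V: "V \<subseteq> X \<and> (\<forall>x\<in>V. \<exists>w. cylinder X w x \<subseteq> V)"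
  show "openin (subshift_space A X) V"
  proof (subst openin_subopen, intro ballI)
    fix x assume x: "x \<in> V"
    then obtain w where w: "cylinder X w x \<subseteq> V" using V by blast
    let ?U = "\<lambda>k. if \<bar>k\<bar> \<le> int w then {x k} else A"
    have "{k. ?U k \<noteq> A} \<subseteq> {- int w..int w}" by auto
    then have "finite {k. ?U k \<noteq> A}" by (rule finite_subset) simp
    moreover have "x k \<in> A" for k using subshift_in_alphabet x V by blast
    ultimately have "openin (full_shift A) (Pi\<^sub>E UNIV ?U)"
      unfolding full_shift_def by (intro product_topology_basis) auto
    moreover have "cylinder X w x = Pi\<^sub>E UNIV ?U \<inter> X"
      using subshift_in_alphabet by (auto simp: cylinder_def PiE_UNIV_domain Pi_iff split: if_splits)
    ultimately have "openin (subshift_space A X) (cylinder X w x)"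
      unfolding subshift_space_def openin_subtopology by blast
    then show "\<exists>T. openin (subshift_space A X) T \<and> x \<in> T \<and> T \<subseteq> V"
      using w cylinder_self x V by blast
  qed
qed

lemma openin_cylinder: "openin (subshift_space A X) (cylinder X w x)"
  unfolding openin_subshift_space_iff
proof (intro conjI ballI)
  fix y assume "y \<in> cylinder X w x"
  then have "cylinder X w y \<subseteq> cylinder X w x" by (auto simp: cylinder_def)
  then show "\<exists>w'. cylinder X w' y \<subseteq> cylinder X w x" ..
qed (rule cylinder_subset)

text \<open>By compactness finitely many cylinders on which \<open>f\<close> is constant cover \<open>X\<close>, and a window that
  contains all of theirs serves for every point.\<close>

lemma locally_constant_imp_finite_window:
  assumes "\<And>x. x \<in> X \<Longrightarrow> \<exists>U. openin (subshift_space A X) U \<and> x \<in> U \<and> (\<forall>y\<in>U. f y = f x)"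
  obtains w where "\<And>x y. x \<in> X \<Longrightarrow> y \<in> cylinder X w x \<Longrightarrow> f y = f x"
proof -
  have "\<exists>w. \<forall>y \<in> cylinder X w x. f y = f x" if "x \<in> X" for x
    using assms[OF that] openin_subshift_space_iff by (meson subsetD)
  then obtain w where w: "\<And>x y. x \<in> X \<Longrightarrow> y \<in> cylinder X (w x) x \<Longrightarrow> f y = f x"
    by metis
  let ?C = "\<lambda>x. cylinder X (w x) x"
  have "X \<subseteq> \<Union> (?C ` X)" using cylinder_self by blast
  then obtain F where F: "finite F" "F \<subseteq> ?C ` X" "X \<subseteq> \<Union> F"
    using compact_subshift_space openin_cylinder unfolding compact_space_alt
    by (metis (no_types, lifting) imageE topspace_subshift_space)
  then obtain Y where Y: "finite Y" "Y \<subseteq> X" "X \<subseteq> \<Union> (?C ` Y)"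
    using finite_subset_image[OF F(1,2)] by metis
  show thesis
  proof
    fix x y assume x: "x \<in> X" and y: "y \<in> cylinder X (\<Sum>z\<in>Y. w z) x"
    obtain z where z: "z \<in> Y" "x \<in> ?C z" using x Y(3) by blast
    have "w z \<le> (\<Sum>z\<in>Y. w z)" using Y(1) z(1) by (intro member_le_sum) auto
    then have "y \<in> cylinder X (w z) x" using cylinder_anti_mono y by blast
    then have "y \<in> ?C z" using z(2) by (auto simp: cylinder_def)
    then show "f y = f x" using w z Y(2) by (metis subsetD)
  qed
qed

lemma openin_vimage_shift_by:
  assumes "openin (subshift_space A X) U"
  shows "openin (subshift_space A X) {x \<in> X. shift_by m x \<in> U}"
  unfolding openin_subshift_space_iff
proof (intro conjI ballI)
  fix x assume x: "x \<in> {x \<in> X. shift_by m x \<in> U}"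
  then obtain w where w: "cylinder X w (shift_by m x) \<subseteq> U"
    using assms openin_subshift_space_iff by blast
  have inv: "shift ` X = X" using sub by (simp add: subshift_def)
  have "shift_by m y \<in> cylinder X w (shift_by m x)"
    if "y \<in> cylinder X (w + nat \<bar>m\<bar>) x" for y
    using that shift_by_in[OF inv, of y m] by (auto simp: cylinder_def shift_by_def)
  then have "cylinder X (w + nat \<bar>m\<bar>) x \<subseteq> {x \<in> X. shift_by m x \<in> U}"
    using w cylinder_subset by blast
  then show "\<exists>w'. cylinder X w' x \<subseteq> {x \<in> X. shift_by m x \<in> U}" ..
qed auto

lemma continuous_map_shift_by:
  "continuous_map (subshift_space A X) (subshift_space A X) (shift_by m)"
  using openin_vimage_shift_by shift_by_in[of X] sub
  by (auto simp: continuous_map_def subshift_def)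

section \<open>Minimality: aperiodicity and bounded return times\<close>

lemma full_orbit_shift:
  assumes "x \<in> X"
  shows "full_orbit (subshift_space A X) shift x = range (\<lambda>m. shift_by m x)"
proof -
  have inv: "shift ` X = X" using sub by (simp add: subshift_def)
  have "inj_on shift X"
    by (auto simp: inj_on_def shift_def fun_eq_iff) (metis diff_add_cancel)
  then have step: "inv_into X shift y = shift_by (- 1) y" if "y \<in> X" for y
    using shift_by_in[OF inv that] by (intro inv_into_f_eq) (simp_all add: shift_eq_shift_by)
  have bwd: "(inv_into X shift ^^ n) x = shift_by (- int n) x" for n
  proof (induction n)
    case (Suc n)
    then show ?case using step shift_by_in[OF inv assms] by simp
  qed simp
  have "shift_by m x \<in> full_orbit (subshift_space A X) shift x" for m
  proof (cases "m \<ge> 0")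
    case True
    then have "shift_by m x = (shift ^^ nat m) x" by (simp add: funpow_shift)
    then show ?thesis by (auto simp: full_orbit_def)
  next
    case False
    then have "shift_by m x = (inv_into X shift ^^ nat (- m)) x" by (simp add: bwd)
    then show ?thesis by (auto simp: full_orbit_def)
  qed
  moreover have "full_orbit (subshift_space A X) shift x \<subseteq> range (\<lambda>m. shift_by m x)"
    by (auto simp: full_orbit_def bwd funpow_shift)
  ultimately show ?thesis by blast
qed

context
  assumes minimal: "minimal_system (subshift_space A X) shift"
begin

lemma minimal_orbit_dense:
  assumes "x \<in> X"
  shows "subshift_space A X closure_of range (\<lambda>m. shift_by m x) = X"
  using minimal assms full_orbit_shift by (simp add: minimal_system_def)

text \<open>A periodic orbit is finite, hence closed, and being dense it would be all of \<open>X\<close>.\<close>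

lemma minimal_infinite_aperiodic:
  assumes "infinite X" "x \<in> X" "shift_by m x = shift_by n x"
  shows "m = n"
proof (rule ccontr)
  assume "m \<noteq> n"
  define d where "d = \<bar>m - n\<bar>"
  have "d > 0" using \<open>m \<noteq> n\<close> by (simp add: d_def)
  have "shift_by (m - n) x = x" "shift_by (n - m) x = x"
    using arg_cong[OF assms(3), of "shift_by (- n)"] arg_cong[OF assms(3), of "shift_by (- m)"]
    by simp_all
  then have d: "shift_by d x = x" by (cases "m \<ge> n") (simp_all add: d_def)
  have per: "x (k + d) = x k" for k using fun_cong[OF d, of k] by (simp add: shift_by_def)
  have per_mult: "x (k + d * j) = x k" for k j
  proof (induction j rule: int_induct[of _ 0])
    case (step1 i)
    then show ?case using per[of "k + d * i"] by (simp add: algebra_simps)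
  next
    case (step2 i)
    then show ?case using per[of "k + d * (i - 1)"] by (simp add: algebra_simps)
  qed simp
  have "shift_by i x = shift_by (i mod d) x" for i
    using per_mult[of "_ + i mod d" "i div d"]
    by (simp add: shift_by_def fun_eq_iff add.assoc)
  then have "range (\<lambda>i. shift_by i x) \<subseteq> (\<lambda>i. shift_by i x) ` {0..<d}"
    using \<open>d > 0\<close> by force
  then have fin: "finite (range (\<lambda>i. shift_by i x))" using finite_surj by blast
  moreover have "range (\<lambda>i. shift_by i x) \<subseteq> X"
    using shift_by_in[of X x] assms(2) sub by (auto simp: subshift_def)
  ultimately have "closedin (subshift_space A X) (range (\<lambda>i. shift_by i x))"
    using Hausdorff_subshift_space
    by (simp add: Hausdorff_imp_t1_space closedin_Hausdorff_finite)
  then show False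
    using minimal_orbit_dense[OF assms(2)] fin assms(1) by (metis closure_of_closedin)
qed

text \<open>The sets of points that enter \<open>U\<close> at a given time, positive or negative, cover \<open>X\<close>; a finite
  subcover bounds these times by some \<open>N\<close> in absolute value, and starting from \<open>shift_by N x\<close> makes
  them nonnegative.\<close>

lemma minimal_bounded_return_time:
  assumes U: "openin (subshift_space A X) U" "U \<noteq> {}"
  obtains L :: nat where "\<And>x. x \<in> X \<Longrightarrow> \<exists>i\<le>L. (shift ^^ i) x \<in> U"
proof -
  have inv: "shift ` X = X" using sub by (simp add: subshift_def)
  let ?V = "\<lambda>m. {x \<in> X. shift_by m x \<in> U}"
  have hit: "\<exists>m. x \<in> ?V m" if x: "x \<in> X" for x
  proof -
    have "U \<subseteq> X" using U(1) openin_subset topspace_subshift_space by blast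
    then have "U \<inter> range (\<lambda>m. shift_by m x) \<noteq> {}"
      using minimal_orbit_dense[OF x] U openin_Int_closure_of_eq_empty by blast
    then show ?thesis using x by blast
  qed
  have "X \<subseteq> \<Union> (range ?V)" using hit by blast
  moreover have "\<forall>V\<in>range ?V. openin (subshift_space A X) V"
    using openin_vimage_shift_by U(1) by blast
  ultimately obtain F where F: "finite F" "F \<subseteq> range ?V" "X \<subseteq> \<Union> F"
    using compact_subshift_space unfolding compact_space_alt topspace_subshift_space
    by meson
  obtain M where "finite M" "F = ?V ` M"
    using finite_subset_image[OF F(1,2)] by blast
  then have M: "finite M" "X \<subseteq> \<Union> (?V ` M)" using F(3) by blast+
  define N where "N = (\<Sum>m\<in>M. nat \<bar>m\<bar>)"
  show thesis
  proof (rule that[of "2 * N"])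
    fix x assume "x \<in> X"
    then have "shift_by (int N) x \<in> X" using shift_by_in[OF inv] by blast
    then obtain m where m: "m \<in> M" "shift_by m (shift_by (int N) x) \<in> U" using M(2) by blast
    have "nat \<bar>m\<bar> \<le> N" unfolding N_def using M(1) m(1) by (intro member_le_sum) auto
    then have "nat (m + int N) \<le> 2 * N" "int (nat (m + int N)) = m + int N" by auto
    then show "\<exists>i\<le>2 * N. (shift ^^ i) x \<in> U" using m(2) by (metis funpow_shift shift_by_shift_by)
  qed
qed

end

section \<open>The Morse-Hedlund argument\<close>

lemma finite_words: "finite ((\<lambda>x. map x [a..b]) ` X)"
proof (rule finite_subset)
  show "(\<lambda>x. map x [a..b]) ` X \<subseteq> {xs. set xs \<subseteq> A \<and> length xs = nat (b - a + 1)}"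
    using subshift_in_alphabet by auto
  show "finite {xs. set xs \<subseteq> A \<and> length xs = nat (b - a + 1)}"
    using sub finite_lists_length_eq by (auto simp: subshift_def)
qed

lemma words_translate: "(\<lambda>x. map x [a + m..b + m]) ` X = (\<lambda>x. map x [a..b]) ` X"
proof -
  have inv: "shift ` X = X" using sub by (simp add: subshift_def)
  have "bij_betw (shift_by m) X X"
    using shift_by_in[OF inv] by (intro bij_betw_byWitness[where f' = "shift_by (- m)"]) auto
  then have img: "X = shift_by m ` X" by (simp add: bij_betw_def)
  have "map (shift_by m x) [a..b] = map x [a + m..b + m]" for x :: "int \<Rightarrow> 'a"
    by (rule nth_equalityI) (auto simp: shift_by_def algebra_simps)
  then show ?thesis by (subst (2) img) (simp add: image_image)
qed

end

lemma factor_card_le: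
  assumes "finite (f ` X)" "\<And>x y. x \<in> X \<Longrightarrow> y \<in> X \<Longrightarrow> f x = f y \<Longrightarrow> g x = g y"
  shows "card (g ` X) \<le> card (f ` X)"
proof -
  define h where "h = (\<lambda>v. g (inv_into X f v))"
  have "h (f x) = g x" if "x \<in> X" for x
    unfolding h_def using that by (intro assms(2)) (simp_all add: f_inv_into_f inv_into_into)
  then have "h ` f ` X = g ` X" unfolding image_image by (rule image_cong[OF refl])
  then show ?thesis using card_image_le[OF assms(1), of h] by simp
qed

text \<open>The induced map \<open>g ` X \<rightarrow> f ` X\<close> is onto, so for finite sets the inequality of cardinalities
  forces it to be injective.\<close>

lemma factor_injective_if_card_le:
  assumes "finite (g ` X)" "card (g ` X) \<le> card (f ` X)"
    and "\<And>x y. x \<in> X \<Longrightarrow> y \<in> X \<Longrightarrow> g x = g y \<Longrightarrow> f x = f y"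
    and "x \<in> X" "y \<in> X" "f x = f y"
  shows "g x = g y"
proof -
  define h where "h = (\<lambda>v. f (inv_into X g v))"
  have h: "h (g z) = f z" if "z \<in> X" for z
    unfolding h_def using that by (intro assms(3)) (simp_all add: f_inv_into_f inv_into_into)
  then have "h ` g ` X = f ` X" unfolding image_image by (rule image_cong[OF refl])
  then have "card (h ` g ` X) = card (g ` X)"
    using assms(2) card_image_le[OF assms(1), of h] by simp
  then have "inj_on h (g ` X)" using assms(1) by (intro eq_card_imp_inj_on)
  moreover have "h (g x) = h (g y)" using h assms(4-6) by simp
  ultimately show ?thesis using assms(4,5) by (meson imageI inj_onD)
qed

text \<open>Deleting the first or the last letter maps the words of length \<open>N + 1\<close> onto those of length
  \<open>N\<close>. When there are no more of the former, both maps are injective, so every word of length \<open>N\<close>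
  extends uniquely to the left and to the right, and hence determines the whole sequence.\<close>

theorem finite_if_complexity_stalls:
  assumes sub: "subshift A X"
    and card: "card ((\<lambda>x. map x [0..int N]) ` X) \<le> card ((\<lambda>x. map x [0..int N - 1]) ` X)"
  shows "finite X"
proof -
  have inv: "shift ` X = X" using sub by (simp add: subshift_def)
  have right: "map x [0..int N] = map y [0..int N]"
    if "x \<in> X" "y \<in> X" "map x [0..int N - 1] = map y [0..int N - 1]" for x y
    by (rule factor_injective_if_card_le[where f = "\<lambda>x. map x [0..int N - 1]",
          OF finite_words[OF sub] card _ that(1,2)]) (use that in auto)
  have card': "card ((\<lambda>x. map x [0..int N]) ` X) \<le> card ((\<lambda>x. map x [1..int N]) ` X)"
    using card words_translate[OF sub, of 0 1 "int N - 1"] by simp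
  have left: "map x [0..int N] = map y [0..int N]"
    if "x \<in> X" "y \<in> X" "map x [1..int N] = map y [1..int N]" for x y
    by (rule factor_injective_if_card_le[where f = "\<lambda>x. map x [1..int N]",
          OF finite_words[OF sub] card' _ that(1,2)]) (use that in auto)
  have ext: "x (m - 1) = y (m - 1) \<and> x (m + int N) = y (m + int N)"
    if xy: "x \<in> X" "y \<in> X" and eq: "\<And>k. m \<le> k \<Longrightarrow> k < m + int N \<Longrightarrow> x k = y k" for x y m
  proof
    have "map (shift_by (m - 1) x) [0..int N] = map (shift_by (m - 1) y) [0..int N]"
      using shift_by_in[OF inv] xy eq by (intro left) (auto simp: shift_by_def)
    then have "\<forall>k\<in>{0..int N}. x (k + (m - 1)) = y (k + (m - 1))"
      by (simp add: shift_by_def)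
    from bspec[OF this, of 0] show "x (m - 1) = y (m - 1)" by simp
    have "map (shift_by m x) [0..int N] = map (shift_by m y) [0..int N]"
      using shift_by_in[OF inv] xy eq by (intro right) (auto simp: shift_by_def)
    then have "\<forall>k\<in>{0..int N}. x (k + m) = y (k + m)"
      by (simp add: shift_by_def)
    from bspec[OF this, of "int N"] show "x (m + int N) = y (m + int N)"
      by (simp add: add.commute)
  qed
  have "inj_on (\<lambda>x. map x [0..int N - 1]) X"
  proof (rule inj_onI)
    fix x y assume xy: "x \<in> X" "y \<in> X" and eq: "map x [0..int N - 1] = map y [0..int N - 1]"
    have all: "x k = y k" if "- int j \<le> k" "k < int N + int j" for j k
      using that
    proof (induction j arbitrary: k)
      case 0
      then show ?case using eq by auto
    next
      case (Suc j)
      have e: "x k = y k" if "m \<le> k" "k < m + int N" "- int j \<le> m" "m \<le> int j" for m k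
        using that by (intro Suc.IH) auto
      have "x (- int j - 1) = y (- int j - 1)" using ext[OF xy e, of "- int j"] by auto
      moreover have "x (int j + int N) = y (int j + int N)" using ext[OF xy e, of "int j"] by auto
      moreover consider "k = - int j - 1" | "k = int j + int N" | "- int j \<le> k" "k < int N + int j"
        using Suc.prems by fastforce
      ultimately show ?case using Suc.IH by cases auto
    qed
    show "x = y"
    proof
      fix k show "x k = y k" using all[of "nat \<bar>k\<bar> + 1" k] by simp
    qed
  qed
  then show ?thesis using finite_words[OF sub] finite_imageD by blast
qed

section \<open>Speedups\<close>

text \<open>Without periodic points \<open>p x\<close> can be recovered from \<open>x\<close> and \<open>S x\<close>: the level sets of \<open>p\<close> are the
  sets where two continuous maps agree, hence closed. As \<open>p\<close> is bounded there are finitely many of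
  them, so each one is open too.\<close>

lemma speedup_jump_locally_constant:
  assumes sub: "subshift A X" and minimal: "minimal_system (subshift_space A X) shift"
    and inf: "infinite X" and speedup: "bounded_speedup (subshift_space A X) shift p S"
    and x: "x \<in> X"
  shows "\<exists>U. openin (subshift_space A X) U \<and> x \<in> U \<and> (\<forall>y\<in>U. p y = p x)"
proof -
  note [simp] = topspace_subshift_space[OF sub]
  let ?L = "\<lambda>j. {y \<in> X. p y = j}"
  have S: "S y = shift_by (int (p y)) y" if "y \<in> X" for y
    using speedup that by (simp add: bounded_speedup_def funpow_shift)
  have "?L j = {y \<in> X. S y = shift_by (int j) y}" for j
    using S minimal_infinite_aperiodic[OF sub minimal inf] by (metis of_nat_eq_iff)
  moreover have "continuous_map (subshift_space A X) (subshift_space A X) S"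
    using speedup by (simp add: bounded_speedup_def homeomorphic_imp_continuous_map)
  ultimately have closed: "closedin (subshift_space A X) (?L j)" for j
    using closedin_continuous_maps_eq[OF Hausdorff_subshift_space[OF sub] _
        continuous_map_shift_by[OF sub], of S "int j"] by simp
  let ?C = "\<Union> (?L ` (p ` X - {p x}))"
  have "finite (p ` X)"
    using speedup by (auto simp: bounded_speedup_def bdd_above_nat)
  then have "closedin (subshift_space A X) ?C" using closed by (intro closedin_Union) auto
  then have "openin (subshift_space A X) (X - ?C)"
    using openin_diff[OF openin_topspace, of "subshift_space A X" ?C] by simp
  moreover have "X - ?C = ?L (p x)" by auto
  ultimately show ?thesis using x by (intro exI[of _ "?L (p x)"]) auto
qed

definition displacement :: "('b \<Rightarrow> nat) \<Rightarrow> ('b \<Rightarrow> 'b) \<Rightarrow> nat \<Rightarrow> 'b \<Rightarrow> nat" where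
  "displacement p S n y = (\<Sum>i<n. p ((S ^^ i) y))"

lemma displacement_add:
  "displacement p S (m + n) y = displacement p S m y + displacement p S n ((S ^^ m) y)"
  by (induction n) (simp_all add: displacement_def funpow_add add.commute)

lemma funpow_speedup:
  assumes "\<And>y. y \<in> X \<Longrightarrow> S y \<in> X" "\<And>y. y \<in> X \<Longrightarrow> S y = shift_by (int (p y)) y" "y \<in> X"
  shows "(S ^^ n) y \<in> X \<and> (S ^^ n) y = shift_by (int (displacement p S n y)) y"
proof (induction n)
  case 0
  then show ?case using assms(3) by (simp add: displacement_def)
next
  case (Suc n)
  then have "S ((S ^^ n) y) = shift_by (int (p ((S ^^ n) y))) ((S ^^ n) y)" using assms(2) by blast
  also have "\<dots> = shift_by (int (displacement p S (Suc n) y)) y"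
    using Suc by (simp add: displacement_def add.commute)
  finally have "(S ^^ Suc n) y = shift_by (int (displacement p S (Suc n) y)) y" by simp
  moreover have "S ((S ^^ n) y) \<in> X" using Suc assms(1) by blast
  then have "(S ^^ Suc n) y \<in> X" by simp
  ultimately show ?case by blast
qed

text \<open>If every \<open>L + 1\<close> consecutive steps contain one that jumps by at least \<open>2\<close>, the surplus of the
  displacement over the number of steps grows linearly.\<close>

lemma displacement_lower_bound:
  assumes closed: "\<And>y. y \<in> X \<Longrightarrow> S y \<in> X" and pos: "\<And>y. y \<in> X \<Longrightarrow> 0 < p y"
    and gap: "\<And>y. y \<in> X \<Longrightarrow> \<exists>i\<le>L. 2 \<le> p ((S ^^ i) y)"
    and y: "y \<in> X"
  shows "(L + 1) * j + j \<le> displacement p S ((L + 1) * j) y"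
  using y
proof (induction j arbitrary: y)
  case (Suc j)
  have orbit: "(S ^^ i) y \<in> X" for i using closed Suc.prems by (induction i) auto
  obtain l where l: "l \<le> L" "2 \<le> p ((S ^^ l) y)" using gap Suc.prems by blast
  have "(\<Sum>i<L + 1. if i = l then 2 else 1) \<le> (\<Sum>i<L + 1. p ((S ^^ i) y))"
    using l pos[OF orbit] by (intro sum_mono) (simp add: Suc_leI)
  moreover have "(\<Sum>i<L + 1. if i = l then 2 else 1) = (\<Sum>i<L + 1. 1 + (if i = l then 1 else (0::nat)))"
    by (intro sum.cong) auto
  then have "(\<Sum>i<L + 1. if i = l then 2 else 1) = L + (2::nat)"
    using l(1) by (simp only: sum.distrib) simp
  ultimately have "L + 2 \<le> displacement p S (L + 1) y" by (simp add: displacement_def)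
  moreover have "(L + 1) * j + j \<le> displacement p S ((L + 1) * j) ((S ^^ (L + 1)) y)"
    by (rule Suc.IH[OF orbit])
  ultimately show ?case
    using displacement_add[of p S "L + 1" "(L + 1) * j" y] by (simp add: algebra_simps)
qed simp

text \<open>Windows that are at least as wide as every jump leave no gap between consecutive points of
  an \<open>S\<close>-orbit, and they reveal where the next point lies.\<close>

lemma speedup_itinerary_determines_word:
  assumes closed: "\<And>y. y \<in> X \<Longrightarrow> S y \<in> X"
    and S: "\<And>y. y \<in> X \<Longrightarrow> S y = shift_by (int (p y)) y"
    and bound: "\<And>y. y \<in> X \<Longrightarrow> p y \<le> w"
    and window: "\<And>y z. y \<in> X \<Longrightarrow> z \<in> cylinder X w y \<Longrightarrow> p z = p y"
    and y: "y \<in> X" and z: "z \<in> X"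
    and same: "\<And>i. i < n \<Longrightarrow> (S ^^ i) z \<in> cylinder X w ((S ^^ i) y)"
  shows "displacement p S n z = displacement p S n y \<and>
    (\<forall>k. 0 \<le> k \<and> k < int (displacement p S n y) \<longrightarrow> z k = y k)"
  using same
proof (induction n)
  case 0
  then show ?case by (auto simp: displacement_def)
next
  case (Suc n)
  let ?q = "displacement p S n y"
  have IH: "displacement p S n z = ?q" "\<And>k. 0 \<le> k \<Longrightarrow> k < int ?q \<Longrightarrow> z k = y k"
    using Suc by auto
  have iter: "(S ^^ n) y \<in> X" "(S ^^ n) y = shift_by (int ?q) y" "(S ^^ n) z = shift_by (int ?q) z"
    using funpow_speedup[of X S p, OF closed S] y z IH(1) by metis+
  have cyl: "(S ^^ n) z \<in> cylinder X w ((S ^^ n) y)" using Suc.prems by simp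
  have "p ((S ^^ n) z) = p ((S ^^ n) y)" using window iter(1) cyl by blast
  moreover have "z k = y k" if k: "0 \<le> k" "k < int (?q + p ((S ^^ n) y))" for k
  proof (cases "k < int ?q")
    case False
    have "p ((S ^^ n) y) \<le> w" using bound iter(1) by blast
    then have "\<bar>k - int ?q\<bar> \<le> int w" using False k by auto
    then have "(S ^^ n) z (k - int ?q) = (S ^^ n) y (k - int ?q)"
      using cyl by (simp add: cylinder_def)
    then show ?thesis by (simp add: iter(2,3) shift_by_def)
  qed (use IH(2) k in blast)
  ultimately show ?case using IH(1) by (simp add: displacement_def)
qed

theorem theorem4p6:
  fixes A :: "'a set" and X :: "(int \<Rightarrow> 'a) set"
    and p :: "(int \<Rightarrow> 'a) \<Rightarrow> nat" and S :: "(int \<Rightarrow> 'a) \<Rightarrow> (int \<Rightarrow> 'a)"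
  assumes "subshift A X"
    and "minimal_system (subshift_space A X) shift"
    and "infinite X"
    and "bounded_speedup (subshift_space A X) shift p S"
    and nontrivial: "\<exists>x\<in>X. p x \<noteq> 1"
  shows "\<not> topologically_conjugate (subshift_space A X) shift (subshift_space A X) S"
proof
  note sub = assms(1) and speedup = assms(4)
  note [simp] = topspace_subshift_space[OF sub]
  have inv: "shift ` X = X" using sub by (simp add: subshift_def)
  assume "topologically_conjugate (subshift_space A X) shift (subshift_space A X) S"
  then obtain \<phi> where homeo: "homeomorphic_map (subshift_space A X) (subshift_space A X) \<phi>"
    and conj: "\<And>x. x \<in> X \<Longrightarrow> \<phi> (shift x) = S (\<phi> x)"
    by (auto simp: topologically_conjugate_def)
  have \<phi>_img: "\<phi> ` X = X"
    using homeomorphic_imp_surjective_map[OF homeo] by simp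
  then have \<phi>_in: "\<phi> x \<in> X" if "x \<in> X" for x using that by (metis imageI)
  have \<phi>_onto: "\<exists>x\<in>X. \<phi> x = y" if "y \<in> X" for y
    using that \<phi>_img by (metis imageE)
  have cont: "continuous_map (subshift_space A X) (subshift_space A X) \<phi>"
    using homeo by (rule homeomorphic_imp_continuous_map)
  have S_closed: "S y \<in> X" if "y \<in> X" for y
    using speedup that homeomorphic_imp_surjective_map[of "subshift_space A X" "subshift_space A X" S]
    by (auto simp: bounded_speedup_def)
  have S: "S y = shift_by (int (p y)) y" and pos: "0 < p y" if "y \<in> X" for y
    using speedup that by (simp_all add: bounded_speedup_def funpow_shift)
  have conj_pow: "(S ^^ i) (\<phi> x) = \<phi> (shift_by (int i) x)" if "x \<in> X" for i x
  proof (induction i)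
    case (Suc i)
    then show ?case
      using conj[OF shift_by_in[OF inv that], of "int i"] by (simp add: shift_eq_shift_by add.commute)
  qed simp
  note p_loc = speedup_jump_locally_constant[OF assms(1-4)]

  obtain b where b: "\<And>y. y \<in> X \<Longrightarrow> p y \<le> b"
    using speedup by (auto simp: bounded_speedup_def bdd_above_def)
  obtain w0 where w0: "\<And>y z. y \<in> X \<Longrightarrow> z \<in> cylinder X w0 y \<Longrightarrow> p z = p y"
    using locally_constant_imp_finite_window[OF sub p_loc] by blast
  define w where "w = max b w0"
  have bound: "p y \<le> w" if "y \<in> X" for y using b[OF that] by (simp add: w_def)
  have window: "p z = p y" if "y \<in> X" "z \<in> cylinder X w y" for y z
    using w0 that cylinder_anti_mono[of w0 w X y] by (auto simp: w_def)

  \<comment> \<open>The central word of \<open>\<phi> x\<close> is represented by the cylinder that it determines.\<close>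
  obtain k where k: "\<And>x y. x \<in> X \<Longrightarrow> y \<in> cylinder X k x \<Longrightarrow>
      cylinder X w (\<phi> y) = cylinder X w (\<phi> x)"
  proof (rule locally_constant_imp_finite_window[OF sub, of "\<lambda>x. cylinder X w (\<phi> x)"])
    fix x assume x: "x \<in> X"
    let ?U = "{y \<in> X. \<phi> y \<in> cylinder X w (\<phi> x)}"
    have "openin (subshift_space A X) ?U"
      using openin_continuous_map_preimage[OF cont openin_cylinder[OF sub]] by simp
    moreover have "x \<in> ?U" using x \<phi>_in by (simp add: cylinder_self)
    moreover have "cylinder X w (\<phi> y) = cylinder X w (\<phi> x)" if "y \<in> ?U" for y
      using that by (auto simp: cylinder_def)
    ultimately show "\<exists>U. openin (subshift_space A X) U \<and> x \<in> U \<and>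
        (\<forall>y\<in>U. cylinder X w (\<phi> y) = cylinder X w (\<phi> x))" by blast
  qed blast

  \<comment> \<open>Along the conjugacy, the minimality of the shift bounds the gaps between jumps by 2 or more.\<close>
  let ?U = "{x \<in> X. 2 \<le> p (\<phi> x)}"
  have "openin (subshift_space A X) {y \<in> X. 2 \<le> p y}"
  proof (subst openin_subopen, intro ballI)
    fix y assume y: "y \<in> {y \<in> X. 2 \<le> p y}"
    obtain V where V: "openin (subshift_space A X) V" "y \<in> V" "\<forall>z\<in>V. p z = p y"
      using p_loc y by blast
    have "V \<subseteq> X" using openin_subset[OF V(1)] by simp
    then have "V \<subseteq> {y \<in> X. 2 \<le> p y}" using V(3) y by auto
    then show "\<exists>T. openin (subshift_space A X) T \<and> y \<in> T \<and> T \<subseteq> {y \<in> X. 2 \<le> p y}"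
      using V(1,2) by blast
  qed
  then have "openin (subshift_space A X) {x \<in> X. \<phi> x \<in> {y \<in> X. 2 \<le> p y}}"
    using openin_continuous_map_preimage[OF cont, of "{y \<in> X. 2 \<le> p y}"] by simp
  moreover have "{x \<in> X. \<phi> x \<in> {y \<in> X. 2 \<le> p y}} = ?U" using \<phi>_in by blast
  ultimately have open_U: "openin (subshift_space A X) ?U" by simp
  have "?U \<noteq> {}"
  proof -
    obtain y where y: "y \<in> X" "p y \<noteq> 1" using nontrivial by blast
    then have "2 \<le> p y" using pos[of y] by simp
    moreover obtain x where "x \<in> X" "\<phi> x = y" using y(1) \<phi>_onto by blast
    ultimately have "x \<in> ?U" by simp
    then show ?thesis by blast
  qed
  then obtain L where L: "\<And>x. x \<in> X \<Longrightarrow> \<exists>i\<le>L. (shift ^^ i) x \<in> ?U"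
    by (rule minimal_bounded_return_time[OF sub assms(2) open_U]) (rule that)
  have gap: "\<exists>i\<le>L. 2 \<le> p ((S ^^ i) y)" if "y \<in> X" for y
  proof -
    obtain x where x: "x \<in> X" "\<phi> x = y" using \<phi>_onto[OF \<open>y \<in> X\<close>] by blast
    then show ?thesis using L[OF x(1)] conj_pow[OF x(1)] by (auto simp: funpow_shift)
  qed

  \<comment> \<open>The window of \<open>\<phi>\<close> costs \<open>2 k\<close> symbols; \<open>2 k + 1\<close> long jumps outweigh this cost.\<close>
  define n where "n = (L + 1) * (2 * k + 1)"
  define N where "N = n + 2 * k"
  have long: "N + 1 \<le> displacement p S n y" if "y \<in> X" for y
    using displacement_lower_bound[of X S p L y "2 * k + 1", OF S_closed pos gap that]
    by (simp add: N_def n_def)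

  have determined: "\<phi> (shift_by (int k) z) i = \<phi> (shift_by (int k) x) i"
    if x: "x \<in> X" and z: "z \<in> X" and i: "0 \<le> i" "i \<le> int N"
      and eq: "\<And>i. 0 \<le> i \<Longrightarrow> i < int N \<Longrightarrow> z i = x i" for x z i
  proof -
    let ?x = "shift_by (int k) x" and ?z = "shift_by (int k) z"
    have X': "?x \<in> X" "?z \<in> X" using shift_by_in[OF inv] x z by auto
    then have \<phi>X: "\<phi> ?x \<in> X" "\<phi> ?z \<in> X" using \<phi>_in by blast+
    have "(S ^^ j) (\<phi> ?z) \<in> cylinder X w ((S ^^ j) (\<phi> ?x))" if j: "j < n" for j
    proof -
      have in_X: "shift_by (int j) ?x \<in> X" "shift_by (int j) ?z \<in> X"
        using shift_by_in[OF inv] X' by blast+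
      have "z (l + (int j + int k)) = x (l + (int j + int k))" if "\<bar>l\<bar> \<le> int k" for l
        using that j by (intro eq) (auto simp: N_def)
      then have "shift_by (int j) ?z \<in> cylinder X k (shift_by (int j) ?x)"
        using in_X by (simp add: cylinder_def shift_by_def add.assoc)
      then have "cylinder X w (\<phi> (shift_by (int j) ?z)) = cylinder X w (\<phi> (shift_by (int j) ?x))"
        using k in_X(1) by blast
      moreover have "\<phi> (shift_by (int j) ?z) \<in> X" using \<phi>_in in_X(2) by blast
      ultimately show ?thesis
        unfolding conj_pow[OF X'(1)] conj_pow[OF X'(2)] using cylinder_self by blast
    qed
    from speedup_itinerary_determines_word[of X S p w, OF S_closed S bound window \<phi>X this]
    show ?thesis using long[OF \<phi>X(1)] i by simp
  qed

  have "bij_betw (shift_by (int k)) X X"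
    using shift_by_in[OF inv] by (intro bij_betw_byWitness[where f' = "shift_by (- int k)"]) auto
  then have onto: "(\<lambda>x. \<phi> (shift_by (int k) x)) ` X = X"
    using \<phi>_img by (metis bij_betw_def image_image)
  have "(\<lambda>x. map x [0..int N]) ` X
      = (\<lambda>x. map x [0..int N]) ` (\<lambda>x. \<phi> (shift_by (int k) x)) ` X"
    by (simp only: onto)
  also have "\<dots> = (\<lambda>x. map (\<phi> (shift_by (int k) x)) [0..int N]) ` X"
    by (simp only: image_image)
  also have "card \<dots> \<le> card ((\<lambda>x. map x [0..int N - 1]) ` X)"
  proof (rule factor_card_le[OF finite_words[OF sub]])
    fix x z assume x: "x \<in> X" and z: "z \<in> X"
      and "map x [0..int N - 1] = map z [0..int N - 1]"
    then have "z i = x i" if "0 \<le> i" "i < int N" for i using that by simp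
    then have "\<phi> (shift_by (int k) x) i = \<phi> (shift_by (int k) z) i"
      if "0 \<le> i" "i \<le> int N" for i
      by (rule determined[OF x z that, symmetric])
    then show "map (\<phi> (shift_by (int k) x)) [0..int N] = map (\<phi> (shift_by (int k) z)) [0..int N]"
      by (intro map_cong) auto
  qed
  finally have "finite X" by (rule finite_if_complexity_stalls[OF sub])
  then show False using assms(3) by simp
qed

end
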